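(* There exists an infinite perfect group $G$ such that for every positive integer $d$ there is a subdirect subgroup of the direct power $G^{2^d}$ which has a nilpotent quotient of class $d$.
   Context: A group $G$ is perfect if $[G,G]=G$. A subgroup of a direct product is subdirect if its projection to each factor is surjective. "Class $d$" means nilpotency class exactly $d$, i.e. the $(d+1)$st term of the lower central series is trivial and the $d$th term is not (with $\gamma_1(H)=H$, $\gamma_{k+1}(H)=[\gamma_k(H),H]$). *)

theory Defs
  imports "HOL-Algebra.Algebra"
begin

definition perfect_group :: "('a, 'b) monoid_scheme \<Rightarrow> bool" where
  "perfect_group G \<longleftrightarrow> group G \<and> derived G (carrier G) = carrier G"

definition subdirect_subgroup ::
    "'i set \<Rightarrow> ('i \<Rightarrow> ('a, 'b) monoid_scheme) \<Rightarrow> ('i \<Rightarrow> 'a) set \<Rightarrow> bool" where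
  "subdirect_subgroup I G H \<longleftrightarrow>
     subgroup H (product_group I G) \<and> (\<forall>i\<in>I. (\<lambda>x. x i) ` H = carrier (G i))"

definition commutator_subgroup ::
    "('a, 'b) monoid_scheme \<Rightarrow> 'a set \<Rightarrow> 'a set \<Rightarrow> 'a set" where
  "commutator_subgroup G A B =
     generate G (\<Union>a\<in>A. \<Union>b\<in>B. {a \<otimes>\<^bsub>G\<^esub> b \<otimes>\<^bsub>G\<^esub> inv\<^bsub>G\<^esub> a \<otimes>\<^bsub>G\<^esub> inv\<^bsub>G\<^esub> b})"

lemma commutator_subgroup_self: "commutator_subgroup G H H = derived G H"
  by (simp add: commutator_subgroup_def derived_def)

text \<open>The series is indexed from 1; the value at index 0 is a dummy.\<close>

fun lower_central :: "('a, 'b) monoid_scheme \<Rightarrow> nat \<Rightarrow> 'a set" where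
  "lower_central G 0 = carrier G"
| "lower_central G (Suc 0) = carrier G"
| "lower_central G (Suc (Suc k)) = commutator_subgroup G (lower_central G (Suc k)) (carrier G)"

text \<open>The disjunct \<^term>\<open>d = 0\<close> makes the trivial group the one of class 0.\<close>

definition nilpotent_of_class :: "('a, 'b) monoid_scheme \<Rightarrow> nat \<Rightarrow> bool" where
  "nilpotent_of_class G d \<longleftrightarrow>
     group G \<and> lower_central G (Suc d) = {\<one>\<^bsub>G\<^esub>} \<and>
     (d = 0 \<or> lower_central G d \<noteq> {\<one>\<^bsub>G\<^esub>})"

definition has_nilpotent_quotient_of_class :: "('a, 'b) monoid_scheme \<Rightarrow> nat \<Rightarrow> bool" where
  "has_nilpotent_quotient_of_class G d \<longleftrightarrow> (\<exists>N. N \<lhd> G \<and> nilpotent_of_class (G Mod N) d)"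

abbreviation direct_power :: "('a, 'b) monoid_scheme \<Rightarrow> nat \<Rightarrow> (nat \<Rightarrow> 'a) monoid" where
  "direct_power G n \<equiv> product_group {..<n} (\<lambda>_. G)"

text \<open>When such a group \<open>G\<close> is asserted to exist, taking its carrier inside \<^typ>\<open>nat\<close> loses no
  generality: a countable elementary
  substructure of \<open>G\<close>, expanded by predicates for the subgroups and kernels for all \<open>d\<close>,
  again has the required property.\<close>

end

(* Let A be the ring of integer polynomials in the fractional powers t^q (q >= 0 rational) and R
   its ideal of elements without constant term. Then R = R.R, so the group G = E_3(R) generated by
   the elementary matrices over R is perfect, by the relation e_ik(ab) = [e_ij(a), e_jk(b)].

   Put S = {f in A[x] : f(0) in R}. Evaluation at y_k = t^(k+1), which lies in R, maps S onto R,
   hence E_3(S) onto G; the evaluations for k < 2^d together map E_3(S) onto a subdirect subgroup H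
   of G^(2^d). Reduction modulo R sends S onto the ideal (x) of Z[x]. The d-th term of the lower
   central series of E_3(S) contains e_12(x^d), whereas every element of the next term is congruent
   to 1 modulo (R, x^(d+1)). This difference survives in H: a polynomial over A vanishing at all
   the y_k is divisible over A by the product of the x - y_k, which is x^(2^d) modulo R, and 2^d > d. *)

theory Submission
  imports Defs "HOL-Analysis.Cartesian_Space" "HOL-Computational_Algebra.Polynomial"
    "HOL-Library.Poly_Mapping"
begin

section \<open>Lower central series and nilpotent quotients\<close>

lemma (in group_hom) commutator_subgroup_img:
  assumes "A \<subseteq> carrier G" "B \<subseteq> carrier G"
  shows "commutator_subgroup H (h ` A) (h ` B) = h ` commutator_subgroup G A B"
proof -
  let ?c = "\<lambda>K a b. a \<otimes>\<^bsub>K\<^esub> b \<otimes>\<^bsub>K\<^esub> inv\<^bsub>K\<^esub> a \<otimes>\<^bsub>K\<^esub> inv\<^bsub>K\<^esub> b"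
  have c: "?c G a b \<in> carrier G \<and> h (?c G a b) = ?c H (h a) (h b)" if "a \<in> A" "b \<in> B" for a b
  proof -
    have "a \<in> carrier G" "b \<in> carrier G" using assms that by auto
    then show ?thesis by simp
  qed
  have "(\<Union>a\<in>h ` A. \<Union>b\<in>h ` B. {?c H a b}) = (\<Union>a\<in>A. \<Union>b\<in>B. {h (?c G a b)})"
    using c by simp
  also have "\<dots> = h ` (\<Union>a\<in>A. \<Union>b\<in>B. {?c G a b})"
    by blast
  finally have "(\<Union>a\<in>h ` A. \<Union>b\<in>h ` B. {?c H a b}) = h ` (\<Union>a\<in>A. \<Union>b\<in>B. {?c G a b})" .
  moreover have "(\<Union>a\<in>A. \<Union>b\<in>B. {?c G a b}) \<subseteq> carrier G"
    using c by blast
  ultimately show ?thesis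
    unfolding commutator_subgroup_def by (simp add: generate_img)
qed

text \<open>A conjugate of a commutator is the commutator of the conjugates, and \<open>A\<close> is
  normal, so the generating set is closed under conjugation.\<close>

lemma (in group) commutator_subgroup_carrier_normal:
  assumes "A \<lhd> G"
  shows "commutator_subgroup G A (carrier G) \<lhd> G"
  unfolding commutator_subgroup_def
proof (rule normal_generateI)
  interpret A: normal A G by fact
  show "(\<Union>a\<in>A. \<Union>b\<in>carrier G. {a \<otimes> b \<otimes> inv a \<otimes> inv b}) \<subseteq> carrier G"
    using A.subset by auto
  fix h g assume h: "h \<in> (\<Union>a\<in>A. \<Union>b\<in>carrier G. {a \<otimes> b \<otimes> inv a \<otimes> inv b})" and g: "g \<in> carrier G"
  from h obtain a b where ab: "a \<in> A" "b \<in> carrier G" and heq: "h = a \<otimes> b \<otimes> inv a \<otimes> inv b" by auto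
  have a: "a \<in> carrier G" using ab A.subset by auto
  let ?a = "g \<otimes> a \<otimes> inv g" and ?b = "g \<otimes> b \<otimes> inv g"
  have cancel: "inv g \<otimes> (g \<otimes> x) = x" if "x \<in> carrier G" for x
    using g that by (simp add: m_assoc[symmetric])
  have "?a \<in> A" using A.inv_op_closed2[OF g ab(1)] .
  moreover have "?b \<in> carrier G" using g ab by simp
  moreover have "g \<otimes> h \<otimes> inv g = ?a \<otimes> ?b \<otimes> inv ?a \<otimes> inv ?b"
    using a ab(2) g by (simp add: heq inv_mult_group m_assoc cancel)
  ultimately show "g \<otimes> h \<otimes> inv g \<in> (\<Union>a\<in>A. \<Union>b\<in>carrier G. {a \<otimes> b \<otimes> inv a \<otimes> inv b})"
    by blast
qed

lemma (in group) carrier_normal: "carrier G \<lhd> G"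
  by (simp add: normal_invI subgroup_self)

lemma (in group) lower_central_normal: "lower_central G n \<lhd> G"
proof (induction n)
  case (Suc n)
  then show ?case
    by (cases n) (simp_all add: carrier_normal commutator_subgroup_carrier_normal)
qed (simp add: carrier_normal)

lemma (in group) lower_central_subset: "lower_central G n \<subseteq> carrier G"
  using normal_imp_subgroup[OF lower_central_normal] subgroup.subset by blast

text \<open>Surjectivity enters at every step: the second argument of each commutator runs over the
  whole carrier.\<close>

lemma (in group_hom) lower_central_img:
  assumes "h ` carrier G = carrier H"
  shows "lower_central H n = h ` lower_central G n"
proof (induction n)
  case (Suc n)
  show ?case
  proof (cases n)
    case 0
    then show ?thesis by (simp add: assms)
  next
    case (Suc k)
    then show ?thesis
      using commutator_subgroup_img[OF G.lower_central_subset[of n] order.refl] Suc.IH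
      by (simp add: assms)
  qed
qed (simp add: assms)

lemma (in group) lower_central_Mod:
  assumes "N \<lhd> G"
  shows "lower_central (G Mod N) n = (#>) N ` lower_central G n"
proof -
  interpret N: normal N G by fact
  interpret group_hom G "G Mod N" "(#>) N"
    by (intro group_hom.intro group_hom_axioms.intro is_group N.factorgroup_is_group N.r_coset_hom_Mod)
  show ?thesis
    by (rule lower_central_img) (auto simp: FactGroup_def RCOSETS_def)
qed

text \<open>A term of the series becomes trivial in \<open>G Mod N\<close> exactly when it lies in
  \<open>N\<close>. Hence the best choice of \<open>N\<close> is the term with index
  \<open>Suc d\<close>, and no quotient has to be considered explicitly afterwards. The bound on
  \<open>d\<close> excludes the disjunct \<open>d = 0\<close> in the definition of the
  class.\<close>

lemma (in group) has_nilpotent_quotient_of_class_iff: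
  assumes "d \<ge> 1"
  shows "has_nilpotent_quotient_of_class G d \<longleftrightarrow>
           \<not> lower_central G d \<subseteq> lower_central G (Suc d)" (is "?L \<longleftrightarrow> ?R")
proof
  have triv: "lower_central (G Mod N) n = {\<one>\<^bsub>G Mod N\<^esub>} \<longleftrightarrow> lower_central G n \<subseteq> N"
    if N: "N \<lhd> G" for N n
  proof -
    have N': "subgroup N G"
      by (rule normal_imp_subgroup[OF N])
    have one: "\<one> \<in> lower_central G n"
      using normal_imp_subgroup[OF lower_central_normal] subgroup.one_closed by blast
    have coset: "N #> x = N \<longleftrightarrow> x \<in> N" if "x \<in> lower_central G n" for x
      using coset_join1[OF _ _ N'] coset_join2[OF _ N'] lower_central_subset that by blast
    have "(#>) N ` lower_central G n = {N} \<longleftrightarrow> lower_central G n \<subseteq> N"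
      using one coset by blast
    moreover have "\<one>\<^bsub>G Mod N\<^esub> = N"
      by (simp add: FactGroup_def)
    ultimately show ?thesis
      by (simp add: lower_central_Mod[OF N])
  qed
  show ?R if L: ?L
  proof -
    obtain N where N: "N \<lhd> G" and nil: "nilpotent_of_class (G Mod N) d"
      using L unfolding has_nilpotent_quotient_of_class_def by blast
    have "lower_central G (Suc d) \<subseteq> N" "\<not> lower_central G d \<subseteq> N"
      using nil assms unfolding nilpotent_of_class_def triv[OF N] by simp_all
    then show ?thesis by blast
  qed
  show ?L if ?R
  proof -
    let ?N = "lower_central G (Suc d)"
    have N: "?N \<lhd> G"
      by (rule lower_central_normal)
    have "nilpotent_of_class (G Mod ?N) d"
      unfolding nilpotent_of_class_def triv[OF N]
      using normal.factorgroup_is_group[OF N] \<open>?R\<close> by (intro conjI disjI2 order.refl)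
    with N show ?thesis
      unfolding has_nilpotent_quotient_of_class_def by blast
  qed
qed

text \<open>\<open>H\<close> is the image of \<Gamma> under all the \<open>\<phi> i\<close> jointly.
  The class is witnessed by the image of \<open>t\<close>: by \<open>sep\<close>, it differs in some
  coordinate from every element of the next term of the series of \<open>H\<close>.\<close>

lemma subdirect_image_has_nilpotent_quotient:
  assumes hom: "\<And>i. i \<in> I \<Longrightarrow> group_hom \<Gamma> (G i) (\<phi> i)"
    and surj: "\<And>i. i \<in> I \<Longrightarrow> \<phi> i ` carrier \<Gamma> = carrier (G i)"
    and \<Gamma>: "group \<Gamma>"
    and d: "d \<ge> 1" and t: "t \<in> lower_central \<Gamma> d"
    and sep: "\<And>\<gamma>. \<gamma> \<in> lower_central \<Gamma> (Suc d) \<Longrightarrow> \<exists>i\<in>I. \<phi> i \<gamma> \<noteq> \<phi> i t"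
  shows "\<exists>H. subdirect_subgroup I G H \<and>
             has_nilpotent_quotient_of_class ((product_group I G)\<lparr>carrier := H\<rparr>) d"
proof -
  define \<Phi> where "\<Phi> = (\<lambda>\<gamma>. \<lambda>i\<in>I. \<phi> i \<gamma>)"
  define H where "H = \<Phi> ` carrier \<Gamma>"
  interpret \<Gamma>: group \<Gamma> by fact
  have G: "group (G i)" if "i \<in> I" for i
    using group_hom.axioms(2)[OF hom[OF that]] .
  interpret P: group "product_group I G"
    using G by simp
  interpret \<Phi>: group_hom \<Gamma> "product_group I G" \<Phi>
  proof (intro group_hom.intro group_hom_axioms.intro homI)
    fix x y assume xy: "x \<in> carrier \<Gamma>" "y \<in> carrier \<Gamma>"
    show "\<Phi> x \<in> carrier (product_group I G)"
      using xy group_hom.hom_closed[OF hom] by (auto simp: \<Phi>_def)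
    show "\<Phi> (x \<otimes>\<^bsub>\<Gamma>\<^esub> y) = \<Phi> x \<otimes>\<^bsub>product_group I G\<^esub> \<Phi> y"
      using xy group_hom.hom_mult[OF hom] by (auto simp: \<Phi>_def fun_eq_iff)
  qed (use \<Gamma> P.is_group in auto)
  have sub: "subgroup H (product_group I G)"
    unfolding H_def by (rule \<Phi>.img_is_subgroup)
  let ?H = "(product_group I G)\<lparr>carrier := H\<rparr>"
  interpret H: group ?H
    by (rule P.subgroup_imp_group[OF sub])
  \<comment> \<open>The same map with its image as codomain is surjective, so it carries the central
    series of \<Gamma> onto that of \<open>H\<close>.\<close>
  interpret H: group_hom \<Gamma> ?H \<Phi>
    by unfold_locales (auto simp: H_def hom_def \<Phi>.hom_mult)
  have lc: "lower_central ?H n = \<Phi> ` lower_central \<Gamma> n" for n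
    by (rule H.lower_central_img) (simp add: H_def)
  have "\<Phi> t \<notin> lower_central ?H (Suc d)"
  proof
    assume "\<Phi> t \<in> lower_central ?H (Suc d)"
    then obtain \<gamma> where \<gamma>: "\<gamma> \<in> lower_central \<Gamma> (Suc d)" "\<Phi> t = \<Phi> \<gamma>"
      unfolding lc by blast
    have "\<phi> i \<gamma> = \<phi> i t" if "i \<in> I" for i
      using fun_cong[OF \<gamma>(2), of i] that by (simp add: \<Phi>_def)
    then show False
      using sep[OF \<gamma>(1)] by blast
  qed
  then have "has_nilpotent_quotient_of_class ?H d"
    unfolding H.has_nilpotent_quotient_of_class_iff[OF d] using t lc[of d] by blast
  moreover have "subdirect_subgroup I G H"
    using sub surj by (auto simp: subdirect_subgroup_def H_def \<Phi>_def image_image)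
  ultimately show ?thesis by blast
qed

text \<open>Transport of structure along \<open>to_nat\<close>; it moves the matrix group to a
  carrier of natural numbers.\<close>

lemma countable_group_iso_nat:
  fixes K :: "'a::countable monoid"
  assumes "group K"
  obtains G :: "nat monoid" where "group G" "to_nat \<in> iso K G"
proof
  interpret K: group K by fact
  define G :: "nat monoid" where "G = \<lparr>carrier = to_nat ` carrier K,
    monoid.mult = (\<lambda>a b. to_nat (from_nat a \<otimes>\<^bsub>K\<^esub> from_nat b)), one = to_nat \<one>\<^bsub>K\<^esub>\<rparr>"
  show iso: "to_nat \<in> iso K G"
    by (auto simp: iso_def hom_def bij_betw_def G_def)
  \<comment> \<open>\<open>iso_imp_img_group\<close> speaks of the target with its unit replaced by
    the image of the unit; here this changes nothing.\<close>
  have "G\<lparr>one := to_nat \<one>\<^bsub>K\<^esub>\<rparr> = G"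
    by (simp add: G_def)
  then show "group G"
    using K.iso_imp_img_group[OF iso] by simp
qed

lemma (in group_hom) perfect_group_img:
  assumes "perfect_group G" "h ` carrier G = carrier H"
  shows "perfect_group H"
  using assms derived_img[of "carrier G"] unfolding perfect_group_def by auto

section \<open>Groups of elementary matrices\<close>

lemma matrix_diff_ldistrib: "A ** (B - C) = A ** B - A ** C"
  for A :: "'r::ring_1^'n^'m"
  by (simp add: vec_eq_iff matrix_matrix_mult_def right_diff_distrib sum_subtractf)

lemma matrix_diff_rdistrib: "(A - B) ** C = A ** C - B ** C"
  for A :: "'r::ring_1^'n^'m"
  by (simp add: vec_eq_iff matrix_matrix_mult_def left_diff_distrib sum_subtractf)

definition matrix_monoid :: "('r::comm_ring_1^'n^'n) monoid" where
  "matrix_monoid = \<lparr>carrier = UNIV, monoid.mult = (**), one = mat 1\<rparr>"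

definition GL :: "('r::comm_ring_1^'n^'n) monoid" where
  "GL = units_of matrix_monoid"

lemma monoid_matrix_monoid: "Group.monoid matrix_monoid"
  by unfold_locales (simp_all add: matrix_monoid_def matrix_mul_assoc)

lemma group_GL: "group GL"
  unfolding GL_def by (rule monoid.units_group[OF monoid_matrix_monoid])

lemma mult_GL [simp]: "A \<otimes>\<^bsub>GL\<^esub> B = A ** B"
  and one_GL [simp]: "\<one>\<^bsub>GL\<^esub> = mat 1"
  by (simp_all add: GL_def units_of_def matrix_monoid_def)

lemma mem_GL_iff: "A \<in> carrier GL \<longleftrightarrow> (\<exists>B. A ** B = mat 1 \<and> B ** A = mat 1)"
  by (auto simp: GL_def units_of_def Units_def matrix_monoid_def)

text \<open>Size 3 is the smallest that leaves a third index beside any two, as the commutator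
  relation requires. For \<open>i = j\<close> the formula degenerates to the identity.\<close>

definition transvection :: "3 \<Rightarrow> 3 \<Rightarrow> 'r \<Rightarrow> 'r::comm_ring_1^3^3" where
  "transvection i j a = (\<chi> k l. if k = l then 1 else if k = i \<and> l = j then a else 0)"

lemma transvection_mult:
  assumes "i \<noteq> j"
  shows "transvection i j a ** transvection i j b = transvection i j (a + b)"
  using assms exhaust_3[of i] exhaust_3[of j]
  by (auto simp: vec_eq_iff forall_3 matrix_matrix_mult_def sum_3 transvection_def)

lemma transvection_0: "transvection i j 0 = mat 1"
  by (simp add: vec_eq_iff transvection_def mat_def)

lemma transvection_in_GL: "i \<noteq> j \<Longrightarrow> transvection i j a \<in> carrier GL"
  by (auto simp: mem_GL_iff transvection_mult transvection_0 intro: exI[of _ "transvection i j (- a)"])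

lemma inv_transvection: "i \<noteq> j \<Longrightarrow> inv\<^bsub>GL\<^esub> (transvection i j a) = transvection i j (- a)"
  by (intro group.inv_equality group_GL)
    (simp_all add: transvection_mult transvection_0 transvection_in_GL)

text \<open>The relation [e_ij(a), e_jk(b)] = e_ik(ab) with the inverses cleared, so that it can be
  checked entry by entry.\<close>

lemma transvection_swap:
  assumes "i \<noteq> j" "j \<noteq> k" "i \<noteq> k"
  shows "transvection i j a ** transvection j k b =
         transvection i k (a * b) ** transvection j k b ** transvection i j a"
proof -
  have "i = 1 \<or> i = 2 \<or> i = 3" "j = 1 \<or> j = 2 \<or> j = 3" "k = 1 \<or> k = 2 \<or> k = 3"
    by (rule exhaust_3)+
  then show ?thesis
    using assms
    by (elim disjE)
      (simp_all add: vec_eq_iff forall_3 matrix_matrix_mult_def sum_3 transvection_def)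
qed

lemma obtain_third_index:
  fixes i j :: 3
  obtains k where "k \<noteq> i" "k \<noteq> j"
proof -
  have "card {i, j} < card (UNIV :: 3 set)"
    by (simp add: card_insert_if)
  then have "{i, j} \<noteq> UNIV"
    by force
  then show ?thesis
    using that by blast
qed

definition transvections :: "'r set \<Rightarrow> ('r::comm_ring_1^3^3) set" where
  "transvections S = {transvection i j a |i j a. i \<noteq> j \<and> a \<in> S}"

text \<open>For an ideal \<open>S\<close> this is E_3 of a ring without unit, realised inside
  \<open>GL\<close> over the ambient ring.\<close>

definition elementary_group :: "'r set \<Rightarrow> ('r::comm_ring_1^3^3) monoid" where
  "elementary_group S = GL\<lparr>carrier := generate GL (transvections S)\<rparr>"

lemma transvections_subset_GL: "transvections S \<subseteq> carrier GL"
  by (auto simp: transvections_def transvection_in_GL)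

lemma subgroup_transvections: "subgroup (generate GL (transvections S)) GL"
  by (rule group.generate_is_subgroup[OF group_GL transvections_subset_GL])

lemma group_elementary: "group (elementary_group S)"
  unfolding elementary_group_def
  by (rule group.subgroup_imp_group[OF group_GL subgroup_transvections])

lemma mult_elementary [simp]: "A \<otimes>\<^bsub>elementary_group S\<^esub> B = A ** B"
  and one_elementary [simp]: "\<one>\<^bsub>elementary_group S\<^esub> = mat 1"
  and carrier_elementary: "carrier (elementary_group S) = generate GL (transvections S)"
  by (simp_all add: elementary_group_def)

lemma transvection_in_elementary:
  "i \<noteq> j \<Longrightarrow> a \<in> S \<Longrightarrow> transvection i j a \<in> carrier (elementary_group S)"
  by (auto simp: carrier_elementary transvections_def intro: generate.incl)

lemma elementary_inverse:
  assumes "A \<in> carrier (elementary_group S)"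
  shows "A ** inv\<^bsub>elementary_group S\<^esub> A = mat 1" "inv\<^bsub>elementary_group S\<^esub> A ** A = mat 1"
  using group.r_inv[OF group_elementary assms] group.l_inv[OF group_elementary assms] by simp_all

text \<open>The hypotheses ask for membership of the transvections rather than of \<open>a\<close>
  and \<open>b\<close> in \<open>S\<close>: powers of an element of \<open>S\<close> may leave
  \<open>S\<close> while their transvections stay in the group.\<close>

lemma transvection_commutator:
  fixes a b :: "'r::comm_ring_1"
  assumes ijk: "i \<noteq> j" "j \<noteq> k" "i \<noteq> k"
    and x: "transvection i j a \<in> carrier (elementary_group S)"
    and y: "transvection j k b \<in> carrier (elementary_group S)"
  shows "transvection i j a \<otimes>\<^bsub>elementary_group S\<^esub> transvection j k b
      \<otimes>\<^bsub>elementary_group S\<^esub> inv\<^bsub>elementary_group S\<^esub> transvection i j a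
      \<otimes>\<^bsub>elementary_group S\<^esub> inv\<^bsub>elementary_group S\<^esub> transvection j k b
    = transvection i k (a * b)"
proof -
  let ?x = "transvection i j a" and ?y = "transvection j k b"
  let ?z = "transvection i k (a * b)"
  let ?x' = "inv\<^bsub>elementary_group S\<^esub> ?x" and ?y' = "inv\<^bsub>elementary_group S\<^esub> ?y"
  have "?x ** ?y ** ?x' ** ?y' = ?z ** ?y ** (?x ** ?x') ** ?y'"
    by (simp add: transvection_swap[OF ijk] matrix_mul_assoc)
  also have "\<dots> = ?z ** (?y ** ?y')"
    by (simp add: elementary_inverse[OF x] matrix_mul_assoc)
  also have "\<dots> = ?z"
    by (simp add: elementary_inverse[OF y])
  finally show ?thesis by simp
qed

text \<open>With a third index j, every generator e_ik(bc) is the commutator of e_ij(b) and e_jk(c),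
  both of which are again generators.\<close>

lemma perfect_elementary:
  assumes "\<And>a. a \<in> R \<Longrightarrow> \<exists>b\<in>R. \<exists>c\<in>R. a = b * c"
  shows "perfect_group (elementary_group R)"
proof -
  let ?E = "elementary_group R"
  interpret E: group ?E by (rule group_elementary)
  have sub: "subgroup (derived ?E (carrier ?E)) ?E"
    by (rule E.derived_is_subgroup) simp
  have "transvections R \<subseteq> derived ?E (carrier ?E)"
  proof
    fix A :: "'a^3^3" assume "A \<in> transvections R"
    then obtain i k a where ik: "i \<noteq> k" and a: "a \<in> R" and A: "A = transvection i k a"
      by (auto simp: transvections_def)
    obtain b c where bc: "b \<in> R" "c \<in> R" "a = b * c"
      using assms[OF a] by blast
    obtain j where j: "j \<noteq> i" "j \<noteq> k"
      by (rule obtain_third_index)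
    have B: "transvection i j b \<in> carrier ?E" and C: "transvection j k c \<in> carrier ?E"
      using j bc by (auto intro: transvection_in_elementary)
    have "A \<in> derived_set ?E (carrier ?E)"
      using transvection_commutator[OF _ _ ik B C] j
      by (intro UN_I[OF B] UN_I[OF C] singleton_iff[THEN iffD2]) (simp add: A bc(3))
    then show "A \<in> derived ?E (carrier ?E)"
      unfolding derived_def by (rule generate.incl)
  qed
  then have "generate ?E (transvections R) \<subseteq> derived ?E (carrier ?E)"
    by (rule E.generate_subgroup_incl[OF _ sub])
  moreover have "generate ?E (transvections R) = carrier ?E"
    unfolding elementary_group_def
    using group.generate_consistent[OF group_GL _ subgroup_transvections, of "transvections R" R]
    by (auto intro: generate.incl)
  ultimately show ?thesis
    using subgroup.subset[OF sub] E.is_group by (auto simp: perfect_group_def)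
qed

text \<open>Each commutator with e_kj(x) raises the exponent by one and moves one step down the
  series.\<close>

lemma transvection_in_lower_central:
  assumes "x \<in> S" "i \<noteq> j"
  shows "transvection i j (x ^ Suc m) \<in> lower_central (elementary_group S) (Suc m)"
  using assms(2)
proof (induction m arbitrary: i j)
  case 0
  then show ?case using assms(1) by (simp add: transvection_in_elementary)
next
  case (Suc m)
  let ?E = "elementary_group S"
  obtain k where k: "k \<noteq> i" "k \<noteq> j"
    by (rule obtain_third_index)
  let ?A = "transvection i k (x ^ Suc m)" and ?B = "transvection k j x"
  have A: "?A \<in> lower_central ?E (Suc m)"
    by (rule Suc.IH) (use k in simp)
  have B: "?B \<in> carrier ?E"
    using k assms(1) by (simp add: transvection_in_elementary)
  have "?A \<in> carrier ?E"
    using A group.lower_central_subset[OF group_elementary] by blast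
  with B have "transvection i j (x ^ Suc m * x) =
      ?A \<otimes>\<^bsub>?E\<^esub> ?B \<otimes>\<^bsub>?E\<^esub> inv\<^bsub>?E\<^esub> ?A \<otimes>\<^bsub>?E\<^esub> inv\<^bsub>?E\<^esub> ?B"
    using transvection_commutator[of i k j "x ^ Suc m" S x] k Suc.prems by simp
  then have "transvection i j (x ^ Suc m * x) \<in>
      (\<Union>a\<in>lower_central ?E (Suc m). \<Union>b\<in>carrier ?E.
        {a \<otimes>\<^bsub>?E\<^esub> b \<otimes>\<^bsub>?E\<^esub> inv\<^bsub>?E\<^esub> a \<otimes>\<^bsub>?E\<^esub> inv\<^bsub>?E\<^esub> b})"
    by (intro UN_I[OF A] UN_I[OF B] singleton_iff[THEN iffD2])
  then have "transvection i j (x ^ Suc m * x) \<in> lower_central ?E (Suc (Suc m))"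
    unfolding lower_central.simps(3) commutator_subgroup_def by (rule generate.incl)
  then show ?case
    by (simp only: power_Suc2[of x "Suc m"])
qed

section \<open>Congruence subgroups along a filtration\<close>

definition matrices :: "'r set \<Rightarrow> ('r^'n^'n) set" where
  "matrices J = {A. \<forall>i j. A $ i $ j \<in> J}"

text \<open>Thus \<open>I 0\<close> is a subring and the \<open>I m\<close> are a descending chain
  of ideals of it, multiplicative in the index.\<close>

locale ring_filtration =
  fixes I :: "nat \<Rightarrow> 'r::comm_ring_1 set"
  assumes zero: "0 \<in> I m"
    and diff: "a \<in> I m \<Longrightarrow> b \<in> I m \<Longrightarrow> a - b \<in> I m"
    and mult: "a \<in> I m \<Longrightarrow> b \<in> I n \<Longrightarrow> a * b \<in> I (m + n)"
    and one: "1 \<in> I 0"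
    and anti: "I (Suc m) \<subseteq> I m"
begin

lemma uminus: "a \<in> I m \<Longrightarrow> - a \<in> I m"
  using diff[OF zero] by fastforce

lemma add: "a \<in> I m \<Longrightarrow> b \<in> I m \<Longrightarrow> a + b \<in> I m"
  using diff[OF _ uminus] by fastforce

lemma sum: "(\<And>x. x \<in> K \<Longrightarrow> f x \<in> I m) \<Longrightarrow> sum f K \<in> I m"
  by (induction K rule: infinite_finite_induct) (auto intro: zero add)

lemma antimono: "m \<le> n \<Longrightarrow> I n \<subseteq> I m"
  using lift_Suc_antimono_le[of I, OF anti] by blast

lemma matrices_mult:
  "A \<in> matrices (I m) \<Longrightarrow> B \<in> matrices (I n) \<Longrightarrow> A ** B \<in> matrices (I (m + n))"
  by (simp add: matrices_def matrix_matrix_mult_def sum mult)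

lemma matrices_diff:
  "A \<in> matrices (I m) \<Longrightarrow> B \<in> matrices (I m) \<Longrightarrow> A - B \<in> matrices (I m)"
  by (simp add: matrices_def diff)

lemma matrices_add:
  "A \<in> matrices (I m) \<Longrightarrow> B \<in> matrices (I m) \<Longrightarrow> A + B \<in> matrices (I m)"
  by (simp add: matrices_def add)

lemma matrices_antimono: "m \<le> n \<Longrightarrow> matrices (I n) \<subseteq> matrices (I m)"
  using antimono[of m n] unfolding matrices_def by blast

lemma mat_1_in_matrices: "mat 1 \<in> matrices (I 0)"
  by (simp add: matrices_def mat_def zero one)

lemma matrices_0:
  assumes "A - mat 1 \<in> matrices (I m)"
  shows "A \<in> matrices (I 0)"
proof -
  have "A - mat 1 \<in> matrices (I 0)"
    using assms matrices_antimono[of 0 m] by auto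
  then show ?thesis
    using matrices_add[OF _ mat_1_in_matrices, of "A - mat 1"] by simp
qed

lemma matrices_mult_minus_1:
  assumes "A - mat 1 \<in> matrices (I m)" "B - mat 1 \<in> matrices (I m)"
  shows "A ** B - mat 1 \<in> matrices (I m)"
proof -
  have "A ** B - mat 1 = (A - mat 1) ** B + (B - mat 1)"
    by (simp add: matrix_diff_rdistrib)
  moreover have "(A - mat 1) ** B \<in> matrices (I m)"
    using matrices_mult[OF assms(1) matrices_0[OF assms(2)]] by simp
  ultimately show ?thesis
    using matrices_add[OF _ assms(2)] by metis
qed

lemma elementary_minus_1:
  assumes "A \<in> carrier (elementary_group (I (Suc 0)))"
  shows "A - mat 1 \<in> matrices (I (Suc 0))"
proof -
  have T: "transvection i j a - mat 1 \<in> matrices (I (Suc 0))" if "a \<in> I (Suc 0)" for i j a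
    using that by (auto simp: matrices_def transvection_def mat_def zero)
  show ?thesis
    using assms unfolding carrier_elementary
  proof (induction A rule: generate.induct)
    case (eng A B)
    then show ?case by (simp add: matrices_mult_minus_1)
  qed (auto simp: T transvections_def inv_transvection uminus, simp add: matrices_def zero)
qed

text \<open>A commutator of a matrix congruent to 1 modulo \<open>I m\<close> with one congruent to
  1 modulo \<open>I (Suc 0)\<close> is congruent to 1 modulo \<open>I (Suc m)\<close>. This bounds
  the series from above, opposite to \<open>transvection_in_lower_central\<close>.\<close>

lemma lower_central_elementary_minus_1:
  assumes "A \<in> lower_central (elementary_group (I (Suc 0))) m" "m \<ge> 1"
  shows "A - mat 1 \<in> matrices (I m)"
  using assms(2,1)
proof (induction m arbitrary: A rule: nat_induct_at_least)
  case base
  then show ?case by (simp add: elementary_minus_1)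
next
  case (Suc m)
  let ?E = "elementary_group (I (Suc 0))"
  interpret E: group ?E by (rule group_elementary)
  have E0: "A \<in> matrices (I 0)" if "A \<in> carrier ?E" for A
    using matrices_0[OF elementary_minus_1[OF that]] .
  \<comment> \<open>Staying inside \<open>?E\<close> ensures that inverses have entries in
    \<open>I 0\<close>.\<close>
  let ?W = "{A \<in> carrier ?E. A - mat 1 \<in> matrices (I (Suc m))}"
  have W: "subgroup ?W ?E"
  proof (rule E.subgroupI)
    have "mat 1 \<in> ?W"
      using E.one_closed by (simp add: matrices_def zero)
    then show "?W \<noteq> {}" by blast
    fix A assume A: "A \<in> ?W"
    let ?A' = "inv\<^bsub>?E\<^esub> A"
    have "?A' - mat 1 = (mat 1 - A) ** ?A'"
      using A by (simp add: matrix_diff_rdistrib elementary_inverse)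
    moreover have "mat 1 - A \<in> matrices (I (Suc m))"
      using A uminus[of _ "Suc m"] by (fastforce simp: matrices_def)
    moreover have "?A' \<in> carrier ?E"
      using A by simp
    ultimately show "?A' \<in> ?W"
      using matrices_mult[of _ "Suc m" ?A' 0] E0 by simp
    fix B assume B: "B \<in> ?W"
    show "A \<otimes>\<^bsub>?E\<^esub> B \<in> ?W"
      using A B matrices_mult_minus_1 E.m_closed[of A B] by auto
  qed auto
  have comm: "A \<otimes>\<^bsub>?E\<^esub> B \<otimes>\<^bsub>?E\<^esub> inv\<^bsub>?E\<^esub> A \<otimes>\<^bsub>?E\<^esub> inv\<^bsub>?E\<^esub> B \<in> ?W"
    if A: "A \<in> lower_central ?E m" and B: "B \<in> carrier ?E" for A B
  proof -
    have AE: "A \<in> carrier ?E"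
      using A E.lower_central_subset by blast
    let ?A' = "inv\<^bsub>?E\<^esub> A" and ?B' = "inv\<^bsub>?E\<^esub> B"
    have A1: "A - mat 1 \<in> matrices (I m)"
      using Suc.IH A by blast
    have B1: "B - mat 1 \<in> matrices (I (Suc 0))"
      using elementary_minus_1[OF B] .
    \<comment> \<open>With \<open>A = 1 + \<alpha>\<close> and \<open>B = 1 + \<beta>\<close> one has \<open>[A, B] - 1 = (\<alpha>\<beta> - \<beta>\<alpha>) A\<inverse> B\<inverse>\<close>.\<close>
    let ?C = "(A - mat 1) ** (B - mat 1) - (B - mat 1) ** (A - mat 1)"
    have "?C \<in> matrices (I (Suc m))"
      using matrices_diff[OF matrices_mult[OF A1 B1]] matrices_mult[OF B1 A1] by simp
    moreover have "?A' ** ?B' \<in> matrices (I 0)"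
      using matrices_mult[of ?A' 0 ?B' 0] AE B E0 by simp
    ultimately have "?C ** (?A' ** ?B') \<in> matrices (I (Suc m))"
      using matrices_mult[of ?C "Suc m" "?A' ** ?B'" 0] by simp
    also have "?C = A ** B - B ** A"
      by (simp add: matrix_diff_rdistrib matrix_diff_ldistrib)
    also have "(A ** B - B ** A) ** (?A' ** ?B') = A ** B ** ?A' ** ?B' - B ** (A ** ?A') ** ?B'"
      by (simp add: matrix_diff_rdistrib matrix_mul_assoc)
    also have "B ** (A ** ?A') ** ?B' = mat 1"
      by (simp add: elementary_inverse[OF AE] elementary_inverse[OF B])
    finally have "A ** B ** ?A' ** ?B' - mat 1 \<in> matrices (I (Suc m))" .
    moreover have "A \<otimes>\<^bsub>?E\<^esub> B \<otimes>\<^bsub>?E\<^esub> ?A' \<otimes>\<^bsub>?E\<^esub> ?B' \<in> carrier ?E"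
      by (intro E.m_closed E.inv_closed AE B)
    ultimately show ?thesis
      by simp
  qed
  have "(\<Union>A\<in>lower_central ?E m. \<Union>B\<in>carrier ?E.
      {A \<otimes>\<^bsub>?E\<^esub> B \<otimes>\<^bsub>?E\<^esub> inv\<^bsub>?E\<^esub> A \<otimes>\<^bsub>?E\<^esub> inv\<^bsub>?E\<^esub> B}) \<subseteq> ?W"
    by (intro UN_least insert_subsetI comm empty_subsetI)
  then have "commutator_subgroup ?E (lower_central ?E m) (carrier ?E) \<subseteq> ?W"
    unfolding commutator_subgroup_def by (rule E.generate_subgroup_incl[OF _ W])
  \<comment> \<open>Only from index 2 on does \<open>lower_central\<close> unfold to a commutator
    subgroup.\<close>
  moreover obtain k where m: "m = Suc k"
    using Suc.hyps by (cases m) auto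
  ultimately have "lower_central ?E (Suc m) \<subseteq> ?W"
    by (simp only: m lower_central.simps)
  then show ?case
    using Suc.prems by blast
qed

end

section \<open>Evaluation of polynomial matrices\<close>

definition eval_matrix :: "'r::comm_ring_1 \<Rightarrow> 'r poly^'n^'n \<Rightarrow> 'r^'n^'n" where
  "eval_matrix y A = (\<chi> i j. poly (A $ i $ j) y)"

lemma eval_matrix_mult: "eval_matrix y (A ** B) = eval_matrix y A ** eval_matrix y B"
  by (simp add: eval_matrix_def matrix_matrix_mult_def vec_eq_iff poly_sum)

lemma eval_matrix_mat_1: "eval_matrix y (mat 1) = mat 1"
  by (simp add: eval_matrix_def mat_def vec_eq_iff)

lemma eval_transvection: "eval_matrix y (transvection i j p) = transvection i j (poly p y)"
  by (simp add: eval_matrix_def transvection_def vec_eq_iff)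

lemma group_hom_eval_matrix: "group_hom GL GL (eval_matrix y)"
proof (intro group_hom.intro group_hom_axioms.intro group_GL homI)
  fix A :: "'a poly^'n^'n" assume "A \<in> carrier GL"
  then show "eval_matrix y A \<in> carrier GL"
    unfolding mem_GL_iff by (metis eval_matrix_mult eval_matrix_mat_1)
qed (simp add: eval_matrix_mult)

lemma eval_elementary:
  fixes S :: "'r::comm_ring_1 poly set"
  shows "eval_matrix y ` carrier (elementary_group S) =
         carrier (elementary_group ((\<lambda>p. poly p y) ` S))"
proof -
  have "eval_matrix y ` transvections S = transvections ((\<lambda>p. poly p y) ` S)"
    unfolding transvections_def
  proof (intro equalityI subsetI)
    fix A assume "A \<in> {transvection i j a |i j a. i \<noteq> j \<and> a \<in> (\<lambda>p. poly p y) ` S}"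
    then obtain i j p where "i \<noteq> j" "p \<in> S" "A = eval_matrix y (transvection i j p)"
      by (auto simp: eval_transvection)
    then show "A \<in> eval_matrix y ` {transvection i j a |i j a. i \<noteq> j \<and> a \<in> S}"
      by blast
  next
    fix A assume "A \<in> eval_matrix y ` {transvection i j a |i j a. i \<noteq> j \<and> a \<in> S}"
    then obtain i j p where "i \<noteq> j" "p \<in> S" "A = transvection i j (poly p y)"
      by (auto simp: eval_transvection)
    then show "A \<in> {transvection i j a |i j a. i \<noteq> j \<and> a \<in> (\<lambda>p. poly p y) ` S}"
      by blast
  qed
  then show ?thesis
    unfolding carrier_elementary
    by (simp add: group_hom.generate_img[OF group_hom_eval_matrix transvections_subset_GL, symmetric])
qed

section \<open>Polynomials over a subring, filtered modulo an ideal\<close>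

text \<open>\<open>R\<close> is a proper ideal of the subring \<open>A\<close>. The ambient ring is
  a domain so that differences of distinct roots can be cancelled.\<close>

locale subring_ideal =
  fixes A R :: "'c::idom set"
  assumes one_A: "1 \<in> A"
    and diff_A: "a \<in> A \<Longrightarrow> b \<in> A \<Longrightarrow> a - b \<in> A"
    and mult_A: "a \<in> A \<Longrightarrow> b \<in> A \<Longrightarrow> a * b \<in> A"
    and R_subset_A: "R \<subseteq> A"
    and zero_R: "0 \<in> R"
    and diff_R: "a \<in> R \<Longrightarrow> b \<in> R \<Longrightarrow> a - b \<in> R"
    and mult_R: "a \<in> A \<Longrightarrow> b \<in> R \<Longrightarrow> a * b \<in> R"
    and one_notin_R: "1 \<notin> R"
begin

lemma zero_A: "0 \<in> A"
  using zero_R R_subset_A by blast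

lemma add_A: "a \<in> A \<Longrightarrow> b \<in> A \<Longrightarrow> a + b \<in> A"
  using diff_A[of a "0 - b"] diff_A[OF zero_A, of b] by simp

lemma add_R: "a \<in> R \<Longrightarrow> b \<in> R \<Longrightarrow> a + b \<in> R"
  using diff_R[of a "0 - b"] diff_R[OF zero_R, of b] by simp

lemma sum_A: "(\<And>k. k \<in> K \<Longrightarrow> f k \<in> A) \<Longrightarrow> sum f K \<in> A"
  by (induction K rule: infinite_finite_induct) (auto intro: zero_A add_A)

lemma sum_R: "(\<And>k. k \<in> K \<Longrightarrow> f k \<in> R) \<Longrightarrow> sum f K \<in> R"
  by (induction K rule: infinite_finite_induct) (auto intro: zero_R add_R)

text \<open>The preimage in A[x] of the ideal (x^m) of (A/R)[x]; \<open>I 1\<close> is the ring S of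
  the introduction.\<close>

definition I :: "nat \<Rightarrow> 'c poly set" where
  "I m = {f. (\<forall>i. coeff f i \<in> A) \<and> (\<forall>i<m. coeff f i \<in> R)}"

sublocale ring_filtration I
proof
  show "0 \<in> I m" for m
    by (simp add: I_def zero_A zero_R)
  show "a - b \<in> I m" if "a \<in> I m" "b \<in> I m" for a b m
    using that by (simp add: I_def diff_A diff_R)
  show "1 \<in> I 0"
    by (auto simp: I_def zero_A one_A coeff_1)
  show "I (Suc m) \<subseteq> I m" for m
    by (auto simp: I_def)
  show "a * b \<in> I (m + n)" if a: "a \<in> I m" and b: "b \<in> I n" for a b m n
  proof -
    \<comment> \<open>If the indices \<open>j\<close> and \<open>i - j\<close> add up to less than
      \<open>m + n\<close>, then \<open>j < m\<close> or \<open>i - j < n\<close>.\<close>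
    have "coeff a j * coeff b (i - j) \<in> R" if "i < m + n" "j \<le> i" for i j
    proof (cases "j < m")
      case True
      then show ?thesis
        using a b mult_R[of "coeff b (i - j)" "coeff a j"] by (simp add: I_def mult.commute)
    next
      case False
      then have "i - j < n" using that by linarith
      then show ?thesis
        using a b mult_R by (simp add: I_def)
    qed
    then show ?thesis
      using a b unfolding I_def mem_Collect_eq Polynomial.coeff_mult by (auto intro!: sum_A sum_R mult_A)
  qed
qed

lemma pCons_in_I_0: "pCons a p \<in> I 0 \<longleftrightarrow> a \<in> A \<and> p \<in> I 0"
  by (auto simp: I_def coeff_pCons split: nat.splits)

lemma poly_in_A: "p \<in> I 0 \<Longrightarrow> y \<in> A \<Longrightarrow> poly p y \<in> A"
  by (induction p) (auto simp: pCons_in_I_0 zero_A intro: add_A mult_A)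

lemma poly_in_R:
  assumes "p \<in> I (Suc 0)" "y \<in> R"
  shows "poly p y \<in> R"
proof (cases p)
  case (pCons a q)
  have "pCons a q \<in> I 0" "a \<in> R"
    using assms(1) anti[of 0] by (auto simp: pCons I_def)
  then have "a + poly q y * y \<in> R"
    using assms(2) poly_in_A[of q y] R_subset_A by (auto simp: pCons_in_I_0 intro!: add_R mult_R)
  then show ?thesis
    by (simp add: pCons mult.commute)
qed

lemma eval_I_1:
  assumes "y \<in> R"
  shows "(\<lambda>p. poly p y) ` I (Suc 0) = R"
proof
  show "(\<lambda>p. poly p y) ` I (Suc 0) \<subseteq> R"
    using poly_in_R[OF _ assms] by blast
  show "R \<subseteq> (\<lambda>p. poly p y) ` I (Suc 0)"
  proof
    fix r assume r: "r \<in> R"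
    have "[:r:] \<in> I (Suc 0)"
      using r R_subset_A by (auto simp: I_def zero_A coeff_pCons split: nat.splits)
    then show "r \<in> (\<lambda>p. poly p y) ` I (Suc 0)"
      by (intro image_eqI[of _ _ "[:r:]"]) simp_all
  qed
qed

text \<open>The divisor x - y is monic, so no coefficient has to be divided and the quotient stays
  over \<open>A\<close>.\<close>

lemma synthetic_div_in_I_0:
  "p \<in> I 0 \<Longrightarrow> y \<in> A \<Longrightarrow> synthetic_div p y \<in> I 0"
  by (induction p) (auto simp: pCons_in_I_0 poly_in_A)

text \<open>Modulo \<open>R\<close>, each factor \<open>x - y\<close> with \<open>y \<in> R\<close> becomes \<open>x\<close>.\<close>

lemma common_roots_in_I:
  assumes "finite Y" "Y \<subseteq> R" "f \<in> I 0" "\<And>y. y \<in> Y \<Longrightarrow> poly f y = 0"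
  shows "f \<in> I (card Y)"
  using assms
proof (induction Y arbitrary: f rule: finite_induct)
  case empty
  then show ?case by simp
next
  case (insert y Y)
  let ?g = "synthetic_div f y"
  have y: "y \<in> R" "y \<in> A"
    using insert.prems R_subset_A by auto
  have f: "f = [:- y, 1:] * ?g"
    using synthetic_div_correct'[of y f] insert.prems(3)[of y] by simp
  have g: "?g \<in> I 0"
    using synthetic_div_in_I_0 insert.prems(2) y(2) by blast
  \<comment> \<open>The factor x - y does not vanish at \<open>z\<close>, which differs from
    \<open>y\<close>, so the root passes to the quotient.\<close>
  have "poly ?g z = 0" if z: "z \<in> Y" for z
  proof -
    have "(z - y) * poly ?g z = 0"
      using insert.prems(3)[of z] z arg_cong[OF f, of "\<lambda>p. poly p z"]
      by (simp add: algebra_simps)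
    then show ?thesis
      using z insert.hyps(2) by auto
  qed
  then have "?g \<in> I (card Y)"
    using insert.IH[OF _ g] insert.prems(1) by blast
  moreover have "[:- y, 1:] \<in> I 1"
    using y diff_R[OF zero_R, of y] R_subset_A one_A
    by (auto simp: I_def zero_A coeff_pCons split: nat.splits)
  ultimately have "[:- y, 1:] * ?g \<in> I (Suc (card Y))"
    using mult[of "[:- y, 1:]" 1] by fastforce
  then show ?case
    using insert.hyps f by simp
qed

text \<open>Compare the entries at (1, 2), where the identity matrix contributes 0. If all
  evaluations agreed, the difference \<open>f\<close> would have \<open>n\<close> roots in
  \<open>R\<close> and so lie in \<open>I n\<close>, hence in \<open>I (Suc d)\<close>. As the entry
  of \<open>M\<close> lies there too, so would x^d, whose coefficient 1 at index \<open>d\<close> is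
  not in \<open>R\<close>.\<close>

lemma transvection_separated:
  assumes y: "inj_on y {..<n}" "\<And>k. k < n \<Longrightarrow> y k \<in> R" and n: "d < n"
    and M: "M \<in> lower_central (elementary_group (I 1)) (Suc d)"
  shows "\<exists>k<n. eval_matrix (y k) M \<noteq> eval_matrix (y k) (transvection 1 2 ([:0, 1:] ^ d))"
proof (rule ccontr)
  assume "\<not> ?thesis"
  then have eq: "eval_matrix (y k) M = eval_matrix (y k) (transvection 1 2 ([:0, 1:] ^ d))"
    if "k < n" for k using that by blast
  let ?x = "[:0, 1:] ^ d :: 'c poly"
  define f where "f = M $ 1 $ 2 - ?x"
  have "M - mat 1 \<in> matrices (I (Suc d))"
    using lower_central_elementary_minus_1[of M "Suc d"] M by simp
  then have "(M - mat 1) $ 1 $ 2 \<in> I (Suc d)"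
    by (auto simp: matrices_def)
  then have M12: "M $ 1 $ 2 \<in> I (Suc d)"
    by (simp add: mat_def)
  have x: "?x = monom 1 d"
    by (simp add: monom_altdef)
  have "?x \<in> I 0"
    by (auto simp: x I_def zero_A one_A)
  then have "f \<in> I 0"
    using M12 antimono[of 0 "Suc d"] unfolding f_def by (intro diff) auto
  moreover have "poly f (y k) = 0" if "k < n" for k
    using eq[OF that] by (auto simp: f_def eval_matrix_def transvection_def vec_eq_iff)
  ultimately have "f \<in> I (card (y ` {..<n}))"
    using y by (intro common_roots_in_I) auto
  then have "f \<in> I (Suc d)"
    using antimono[of "Suc d" n] n by (auto simp: card_image[OF y(1)])
  then have "M $ 1 $ 2 - f \<in> I (Suc d)"
    using M12 by (intro diff)
  then have "?x \<in> I (Suc d)"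
    by (simp add: f_def)
  then show False
    using one_notin_R by (auto simp: x I_def)
qed

end

section \<open>The coefficient ring: polynomials in rational powers of t\<close>

text \<open>A finitely supported function is encoded by a list of the pairs in its graph over the
  support. This makes the matrices countable, so that \<open>to_nat\<close> applies to them.\<close>

lemma poly_mapping_inj_nat:
  "\<exists>h :: ('a::countable \<Rightarrow>\<^sub>0 'b::{countable, zero}) \<Rightarrow> nat. inj h"
proof -
  define g :: "('a \<Rightarrow>\<^sub>0 'b) \<Rightarrow> ('a \<times> 'b) set" where
    "g f = (\<lambda>k. (k, Poly_Mapping.lookup f k)) ` Poly_Mapping.keys f" for f
  have "\<exists>xs. set xs = g f" for f
    unfolding g_def by (intro finite_list) simp
  then obtain L where L: "\<And>f. set (L f) = g f"
    by metis
  \<comment> \<open>The nonzero values determine \<open>f\<close>, since 0 is the default off the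
    support.\<close>
  have lookup: "Poly_Mapping.lookup f k = v \<longleftrightarrow> (k, v) \<in> g f" if "v \<noteq> 0" for f k v
    using that by (auto simp: g_def in_keys_iff)
  have "inj (to_nat \<circ> L)"
  proof (rule injI)
    fix f f' assume "(to_nat \<circ> L) f = (to_nat \<circ> L) f'"
    then have "g f = g f'"
      by (metis L comp_apply to_nat_split)
    then show "f = f'"
      by (intro poly_mapping_eqI) (metis lookup)
  qed
  then show ?thesis by blast
qed

instance poly_mapping :: (countable, "{countable, zero}") countable
  by standard (rule poly_mapping_inj_nat)

text \<open>The type \<open>rat \<Rightarrow>\<^sub>0 int\<close> is the group ring \<open>Z[t^q | q rational]\<close>: the element
  \<open>t^q\<close> is \<open>Poly_Mapping.single q 1\<close>.\<close>

definition puiseux :: "(rat \<Rightarrow>\<^sub>0 int) set" where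
  "puiseux = {f. \<forall>q\<in>Poly_Mapping.keys f. 0 \<le> q}"

definition puiseux_ideal :: "(rat \<Rightarrow>\<^sub>0 int) set" where
  "puiseux_ideal = {f. \<forall>q\<in>Poly_Mapping.keys f. 0 < q}"

text \<open>The ambient group ring is a domain because its exponents form a linearly ordered
  group.\<close>

interpretation puiseux: subring_ideal puiseux puiseux_ideal
proof
  fix a b :: "rat \<Rightarrow>\<^sub>0 int"
  show "1 \<in> puiseux" "1 \<notin> puiseux_ideal" "0 \<in> puiseux_ideal" "puiseux_ideal \<subseteq> puiseux"
    by (auto simp: puiseux_def puiseux_ideal_def)
  show "a - b \<in> puiseux" if "a \<in> puiseux" "b \<in> puiseux"
    using that keys_diff[of a b] by (auto simp: puiseux_def)
  show "a - b \<in> puiseux_ideal" if "a \<in> puiseux_ideal" "b \<in> puiseux_ideal"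
    using that keys_diff[of a b] by (auto simp: puiseux_ideal_def)
  show "a * b \<in> puiseux" if "a \<in> puiseux" "b \<in> puiseux"
    using that keys_mult[of a b] by (fastforce simp: puiseux_def)
  show "a * b \<in> puiseux_ideal" if "a \<in> puiseux" "b \<in> puiseux_ideal"
    using that keys_mult[of a b] by (fastforce simp: puiseux_def puiseux_ideal_def intro: add_nonneg_pos)
qed

lemma puiseux_ideal_factor:
  assumes f: "f \<in> puiseux_ideal"
  shows "\<exists>b\<in>puiseux_ideal. \<exists>c\<in>puiseux_ideal. f = b * c"
proof (cases "f = 0")
  case True
  then show ?thesis
    using f by (intro bexI[of _ f]) auto
next
  case False
  \<comment> \<open>Half of the lowest exponent can be split off, so that both factors have positive exponents.\<close>
  define q where "q = Min (Poly_Mapping.keys f) / 2"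
  have q: "0 < q" "\<And>k. k \<in> Poly_Mapping.keys f \<Longrightarrow> 2 * q \<le> k"
    using False f by (auto simp: q_def puiseux_ideal_def)
  \<comment> \<open>Multiplication by t^(-q) leaves \<open>puiseux\<close> in general, but the
    exponents of \<open>f\<close> are at least 2q, so those of \<open>?c\<close> are at least
    q.\<close>
  let ?b = "Poly_Mapping.single q 1 :: rat \<Rightarrow>\<^sub>0 int"
  let ?c = "Poly_Mapping.single (- q) 1 * f"
  have "?b \<in> puiseux_ideal"
    using q by (simp add: puiseux_ideal_def)
  moreover have "?c \<in> puiseux_ideal"
    using q keys_mult[of "Poly_Mapping.single (- q) 1" f] by (fastforce simp: puiseux_ideal_def)
  moreover have "f = ?b * ?c"
    by (simp add: mult.assoc[symmetric] mult_single)
  ultimately show ?thesis by blast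
qed

theorem mainTheorem3:
  shows "\<exists>G :: nat monoid. perfect_group G \<and> infinite (carrier G) \<and>
    (\<forall>d::nat. d \<ge> 1 \<longrightarrow>
      (\<exists>H. subdirect_subgroup {..<2 ^ d} (\<lambda>_. G) H \<and>
           has_nilpotent_quotient_of_class ((direct_power G (2 ^ d))\<lparr>carrier := H\<rparr>) d))"
proof -
  let ?E = "elementary_group puiseux_ideal"
  let ?\<Gamma> = "elementary_group (puiseux.I 1)"
  \<comment> \<open>The shift by one keeps the exponent positive: t^0 = 1 is not in the
    ideal.\<close>
  define y :: "nat \<Rightarrow> rat \<Rightarrow>\<^sub>0 int" where
    "y k = Poly_Mapping.single (of_nat (Suc k)) 1" for k
  have y: "y k \<in> puiseux_ideal" for k
    by (simp add: y_def puiseux_ideal_def del: of_nat_Suc)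
  have inj_y: "inj y"
  proof (rule injI)
    fix k l assume "y k = y l"
    then have "Poly_Mapping.keys (y k) = Poly_Mapping.keys (y l)" by simp
    then show "k = l" by (simp add: y_def)
  qed
  obtain G :: "nat monoid" where G: "group G" and iso: "to_nat \<in> iso ?E G"
    using countable_group_iso_nat[OF group_elementary] .
  have hom_G: "group_hom ?E G to_nat"
    using iso G by (auto simp: group_hom_def group_hom_axioms_def iso_def group_elementary)
  have onto_G: "to_nat ` carrier ?E = carrier G"
    using iso by (auto simp: iso_def bij_betw_def)
  have "perfect_group G"
    using group_hom.perfect_group_img[OF hom_G perfect_elementary onto_G] puiseux_ideal_factor by blast
  moreover have "infinite (carrier G)"
  proof -
    have "inj (\<lambda>k. to_nat (transvection 1 2 (y k)))"
      by (rule injI) (auto simp: transvection_def vec_eq_iff forall_3 injD[OF inj_y])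
    moreover have "range (\<lambda>k. to_nat (transvection 1 2 (y k))) \<subseteq> carrier G"
      using y by (auto simp: onto_G[symmetric] intro!: imageI transvection_in_elementary)
    ultimately show ?thesis
      using infinite_super range_inj_infinite by blast
  qed
  moreover have "\<exists>H. subdirect_subgroup {..<2 ^ d} (\<lambda>_. G) H \<and>
           has_nilpotent_quotient_of_class ((direct_power G (2 ^ d))\<lparr>carrier := H\<rparr>) d"
    if d: "d \<ge> 1" for d :: nat
  proof (rule subdirect_image_has_nilpotent_quotient[of _ ?\<Gamma>])
    \<comment> \<open>Every evaluation is onto because the constants in \<open>puiseux_ideal\<close>
      already belong to \<open>puiseux.I 1\<close>.\<close>
    have eval: "eval_matrix (y k) ` carrier ?\<Gamma> = carrier ?E" for k
      using eval_elementary[of "y k" "puiseux.I 1"] puiseux.eval_I_1[OF y] by simp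
    let ?\<phi> = "\<lambda>k. to_nat \<circ> eval_matrix (y k)"
    show "?\<phi> k ` carrier ?\<Gamma> = carrier G" for k
      unfolding image_comp[symmetric] eval onto_G ..
    show "group_hom ?\<Gamma> G (?\<phi> k)" for k
    proof (intro group_hom.intro group_hom_axioms.intro group_elementary G hom_compose)
      show "eval_matrix (y k) \<in> hom ?\<Gamma> ?E"
        using eval by (intro homI) (auto simp: eval_matrix_mult)
      show "to_nat \<in> hom ?E G"
        using iso by (simp add: iso_def)
    qed
    show "group ?\<Gamma>"
      by (rule group_elementary)
    show "d \<ge> 1" by fact
    let ?t = "transvection 1 2 ([:0, 1:] ^ d)"
    have "[:0, 1:] \<in> puiseux.I 1"
      by (auto simp: puiseux.I_def puiseux.zero_A puiseux.zero_R puiseux.one_A coeff_pCons split: nat.splits)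
    \<comment> \<open>The lemma produces the exponent \<open>Suc m\<close>, hence the instance
      \<open>d - 1\<close>.\<close>
    then show "?t \<in> lower_central ?\<Gamma> d"
      using transvection_in_lower_central[of "[:0, 1:]" "puiseux.I 1" 1 2 "d - 1"] d by simp
    \<comment> \<open>There are enough evaluation points since \<open>d < 2 ^ d\<close>, and the
      injective \<open>to_nat\<close> preserves the difference.\<close>
    show "\<exists>k\<in>{..<2 ^ d}. ?\<phi> k M \<noteq> ?\<phi> k ?t" if "M \<in> lower_central ?\<Gamma> (Suc d)" for M
      using puiseux.transvection_separated[OF inj_on_subset[OF inj_y subset_UNIV] y less_exp that]
      by auto
  qed
  ultimately show ?thesis by blast
qed

end
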